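(* Let $f:\mathbb{R}^d\to\mathbb{R}$ be convex, and let $\mathcal{G}(\mathbf{x};\xi)$ be a stochastic subgradient of $f$. Suppose that for every $\mathbf{x}\in\mathbb{R}^d$ we have $\mathrm{E}[\|\mathcal{G}(\mathbf{x};\xi)-\mathrm{E}[\mathcal{G}(\mathbf{x};\xi)]\|^2]\le\delta^2$ and $\|\partial f(\mathbf{x})\|\le G$ (i.e. every subgradient of $f$ at $\mathbf{x}$ has norm at most $G$). Let $\mathbf{x}_*$ be a minimizer of $f$, let $\beta\in[0,1)$, $s\ge 0$, $C>0$, let $t\ge 0$ be an integer, and let $\{\mathbf{x}_k\}$ be generated by the stochastic unified momentum (SUM) method started at $\mathbf{x}_0$ with parameters $\beta$, $s$ and step size $\alpha=\frac{C}{\sqrt{t+1}}$. Put $\widehat{\mathbf{x}}_t=\frac{1}{t+1}\sum_{k=0}^t\mathbf{x}_k$. Then $$\mathrm{E}[f(\widehat{\mathbf{x}}_t)-f(\mathbf{x}_* )]\le\frac{\beta(f(\mathbf{x}_0)-f(\mathbf{x}_* ))}{(1-\beta)(t+1)}+\frac{(1-\beta)\|\mathbf{x}_0-\mathbf{x}_*\|^2}{2C\sqrt{t+1}}+\frac{C(1+2s\beta)(G^2+\delta^2)}{2(1-\beta)\sqrt{t+1}}.$$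
   Context: $\|\cdot\|$ is the Euclidean norm and $\partial f(\mathbf{x})$ is the set of subgradients of $f$ at $\mathbf{x}$. Stochastic subgradient: $\xi_0,\xi_1,\dots$ are independent random variables distributed as $\xi$, and $\mathrm{E}_{\xi}[\mathcal{G}(\mathbf{x};\xi)]\in\partial f(\mathbf{x})$ for every $\mathbf{x}$ (so, conditionally on $\xi_0,\dots,\xi_{k-1}$, the expectation of $\mathcal{G}(\mathbf{x}_k;\xi_k)$ lies in $\partial f(\mathbf{x}_k)$). SUM method with parameters $\alpha>0$, $\beta\in[0,1)$, $s\ge0$: given a deterministic $\mathbf{x}_0\in\mathbb{R}^d$, set $\mathbf{y}^s_0=\mathbf{x}_0$, and for $k=0,1,2,\dots$, with $\mathcal{G}_k=\mathcal{G}(\mathbf{x}_k;\xi_k)$, $$\mathbf{y}_{k+1}=\mathbf{x}_k-\alpha\mathcal{G}_k,\qquad \mathbf{y}^s_{k+1}=\mathbf{x}_k-s\alpha\mathcal{G}_k,\qquad \mathbf{x}_{k+1}=\mathbf{y}_{k+1}+\beta(\mathbf{y}^s_{k+1}-\mathbf{y}^s_k).$$ *)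

theory Defs
  imports "HOL-Probability.Probability"
begin

definition subdifferential :: "('a::real_inner \<Rightarrow> real) \<Rightarrow> 'a \<Rightarrow> 'a set"
  where "subdifferential f x = {g. \<forall>y. f y \<ge> f x + g \<bullet> (y - x)}"

text \<open>
  The measure \<open>D\<close> is the law of \<open>\<xi>\<close>. Joint measurability of the oracle makes the iterates
  random variables and gives meaning to the expectation of \<open>\<G> x\<^sub>k \<xi>\<^sub>k\<close> conditionally on
  the past. Integrability is explicit because the integral of a non-integrable function is 0.
\<close>

definition stochastic_subgradient ::
    "('a::euclidean_space \<Rightarrow> real) \<Rightarrow> 'z measure \<Rightarrow> ('a \<Rightarrow> 'z \<Rightarrow> 'a) \<Rightarrow> bool"
  where "stochastic_subgradient f D \<G> \<longleftrightarrow>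
    (\<lambda>(x, z). \<G> x z) \<in> borel_measurable (borel \<Otimes>\<^sub>M D) \<and>
    (\<forall>x. integrable D (\<G> x) \<and> (\<integral>z. \<G> x z \<partial>D) \<in> subdifferential f x)"

text \<open>
  One sample path: \<open>z\<close> is a realisation of the samples, \<open>x\<close> the resulting iterates.
  The auxiliary sequences are determined by \<open>x\<close> and \<open>z\<close>, except for the unused \<open>y 0\<close>.
\<close>

definition SUM_method ::
    "real \<Rightarrow> real \<Rightarrow> real \<Rightarrow> ('a::euclidean_space \<Rightarrow> 'z \<Rightarrow> 'a) \<Rightarrow> (nat \<Rightarrow> 'z) \<Rightarrow> 'a \<Rightarrow> (nat \<Rightarrow> 'a) \<Rightarrow> bool"
  where "SUM_method \<alpha> \<beta> s \<G> z x0 x \<longleftrightarrow>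
    (\<exists>y ys. x 0 = x0 \<and> ys 0 = x0 \<and>
      (\<forall>k. y (Suc k) = x k - \<alpha> *\<^sub>R \<G> (x k) (z k) \<and>
           ys (Suc k) = x k - (s * \<alpha>) *\<^sub>R \<G> (x k) (z k) \<and>
           x (Suc k) = y (Suc k) + \<beta> *\<^sub>R (ys (Suc k) - ys k)))"

end

theory Submission
  imports Defs
begin

text \<open>
  The shifted iterate \<open>x\<^sub>k + \<beta> / (1 - \<beta>) (x\<^sub>k - y\<^sup>s\<^sub>k)\<close> performs plain stochastic subgradient steps of
  size \<open>\<alpha> / (1 - \<beta>)\<close>, so its expected squared distance to the minimizer satisfies the usual
  one-step recursion. The extra inner product with the momentum
  \<open>x\<^sub>k - y\<^sup>s\<^sub>k = x\<^sub>k - x\<^sub>k\<^sub>-\<^sub>1 + s \<alpha> \<G>\<^sub>k\<^sub>-\<^sub>1\<close> is bounded below by \<open>f x\<^sub>k - f x\<^sub>k\<^sub>-\<^sub>1\<close>, which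
  telescopes, minus an error of order \<open>s \<alpha> (G\<^sup>2 + \<delta>\<^sup>2)\<close>. Summing over \<open>k\<close> and applying
  Jensen's inequality gives the bound.
\<close>

subsection \<open>Square-integrable random vectors\<close>

text \<open>This class is closed under the linear combinations that make up the recursion, and inner
  products of its members are integrable. Those two facts supply almost all integrability needed
  below.\<close>

definition square_integrable :: "'w measure \<Rightarrow> ('w \<Rightarrow> 'a::euclidean_space) \<Rightarrow> bool"
  where "square_integrable M X \<longleftrightarrow>
    X \<in> borel_measurable M \<and> integrable M (\<lambda>\<omega>. (norm (X \<omega>))\<^sup>2)"

lemma norm_add_square_le: "(norm (a + b))\<^sup>2 \<le> 2 * (norm a)\<^sup>2 + 2 * (norm b)\<^sup>2"
  for a b :: "'a::real_inner"
proof -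
  have "(norm (a + b))\<^sup>2 + (norm (a - b))\<^sup>2 = 2 * (norm a)\<^sup>2 + 2 * (norm b)\<^sup>2"
    by (simp add: power2_norm_eq_inner inner_simps)
  then show ?thesis
    by (smt (verit) zero_le_power2)
qed

lemma abs_inner_le_half_squares: "\<bar>a \<bullet> b\<bar> \<le> ((norm a)\<^sup>2 + (norm b)\<^sup>2) / 2"
  for a b :: "'a::real_inner"
proof -
  have "0 \<le> (norm a - norm b)\<^sup>2"
    by simp
  then have "norm a * norm b \<le> ((norm a)\<^sup>2 + (norm b)\<^sup>2) / 2"
    by (simp add: power2_diff)
  then show ?thesis
    using Cauchy_Schwarz_ineq2[of a b] by linarith
qed

lemma square_integrable_add:
  assumes "square_integrable M X" "square_integrable M Y"
  shows "square_integrable M (\<lambda>\<omega>. X \<omega> + Y \<omega>)"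
proof -
  have [measurable]: "X \<in> borel_measurable M" "Y \<in> borel_measurable M"
    using assms by (auto simp: square_integrable_def)
  have "integrable M (\<lambda>\<omega>. (norm (X \<omega> + Y \<omega>))\<^sup>2)"
  proof (rule Bochner_Integration.integrable_bound)
    show "integrable M (\<lambda>\<omega>. 2 * (norm (X \<omega>))\<^sup>2 + 2 * (norm (Y \<omega>))\<^sup>2)"
      using assms by (auto simp: square_integrable_def)
    show "AE \<omega> in M. norm ((norm (X \<omega> + Y \<omega>))\<^sup>2)
        \<le> norm (2 * (norm (X \<omega>))\<^sup>2 + 2 * (norm (Y \<omega>))\<^sup>2)"
      using norm_add_square_le[of "X _" "Y _"] by simp
  qed measurable
  then show ?thesis
    by (simp add: square_integrable_def)
qed

lemma square_integrable_scaleR: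
  assumes "square_integrable M X"
  shows "square_integrable M (\<lambda>\<omega>. c *\<^sub>R X \<omega>)"
  using assms by (auto simp: square_integrable_def power_mult_distrib)

lemma square_integrable_diff:
  assumes "square_integrable M X" "square_integrable M Y"
  shows "square_integrable M (\<lambda>\<omega>. X \<omega> - Y \<omega>)"
  using square_integrable_add[OF assms(1) square_integrable_scaleR[OF assms(2), of "-1"]] by simp

lemma (in finite_measure) square_integrable_const: "square_integrable M (\<lambda>_. c)"
  by (simp add: square_integrable_def)

lemma integrable_inner_square_integrable:
  assumes "square_integrable M X" "square_integrable M Y"
  shows "integrable M (\<lambda>\<omega>. X \<omega> \<bullet> Y \<omega>)"
proof (rule Bochner_Integration.integrable_bound)
  have [measurable]: "X \<in> borel_measurable M" "Y \<in> borel_measurable M"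
    using assms by (auto simp: square_integrable_def)
  show "(\<lambda>\<omega>. X \<omega> \<bullet> Y \<omega>) \<in> borel_measurable M"
    by measurable
  show "integrable M (\<lambda>\<omega>. ((norm (X \<omega>))\<^sup>2 + (norm (Y \<omega>))\<^sup>2) / 2)"
    using assms by (auto simp: square_integrable_def)
  show "AE \<omega> in M. norm (X \<omega> \<bullet> Y \<omega>) \<le> norm (((norm (X \<omega>))\<^sup>2 + (norm (Y \<omega>))\<^sup>2) / 2)"
    using abs_inner_le_half_squares[of "X _" "Y _"] by simp
qed

lemmas square_integrable_intros =
  square_integrable_add square_integrable_diff square_integrable_scaleR

subsection \<open>Freezing an independent variable\<close>

text \<open>
  The library's \<open>indep_var\<close> forces both variables to have the same value type, so from here
  on independence of a state and a sample is expressed by their joint law being a product.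
\<close>

lemma (in prob_space) joint_law_compose:
  assumes ind: "indep_var N U K V"
    and [measurable]: "F \<in> measurable N S" "H \<in> measurable K T"
  shows "distr M S (\<lambda>\<omega>. F (U \<omega>)) \<Otimes>\<^sub>M distr M T (\<lambda>\<omega>. H (V \<omega>))
    = distr M (S \<Otimes>\<^sub>M T) (\<lambda>\<omega>. (F (U \<omega>), H (V \<omega>)))"
proof -
  have [measurable]: "U \<in> measurable M N" "V \<in> measurable M K"
    and joint: "distr M N U \<Otimes>\<^sub>M distr M K V = distr M (N \<Otimes>\<^sub>M K) (\<lambda>\<omega>. (U \<omega>, V \<omega>))"
    using ind by (auto simp: indep_var_distribution_eq)
  interpret V: prob_space "distr M K V" by (rule prob_space_distr) simp
  interpret H: prob_space "distr (distr M K V) T H" by (rule V.prob_space_distr) simp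
  have "distr (distr M N U) S F \<Otimes>\<^sub>M distr (distr M K V) T H
      = distr (distr M N U \<Otimes>\<^sub>M distr M K V) (S \<Otimes>\<^sub>M T) (\<lambda>(u, v). (F u, H v))"
    by (rule pair_measure_distr) (simp_all add: H.sigma_finite_measure_axioms)
  then show ?thesis
    unfolding joint by (simp add: distr_distr comp_def)
qed

text \<open>Fubini on the product law. This does the work of conditioning on \<open>U\<close>: the
  sample is averaged out while the state is held fixed.\<close>

lemma (in prob_space) integral_indep_pair:
  fixes h :: "'b \<times> 'c \<Rightarrow> 'd::{banach, second_countable_topology}"
  assumes [measurable]: "U \<in> measurable M N" "V \<in> measurable M D"
    and joint: "distr M N U \<Otimes>\<^sub>M distr M D V = distr M (N \<Otimes>\<^sub>M D) (\<lambda>\<omega>. (U \<omega>, V \<omega>))"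
    and h[measurable]: "h \<in> borel_measurable (N \<Otimes>\<^sub>M D)"
    and int: "integrable M (\<lambda>\<omega>. h (U \<omega>, V \<omega>))"
  shows "(\<integral>\<omega>. h (U \<omega>, V \<omega>) \<partial>M) = (\<integral>\<omega>. (\<integral>z. h (U \<omega>, z) \<partial>distr M D V) \<partial>M)"
proof -
  interpret U: prob_space "distr M N U" by (rule prob_space_distr) simp
  interpret V: prob_space "distr M D V" by (rule prob_space_distr) simp
  interpret pair_sigma_finite "distr M N U" "distr M D V" ..
  have "integrable (distr M N U \<Otimes>\<^sub>M distr M D V) h"
    unfolding joint using int by (subst integrable_distr_eq) auto
  from integral_fst'[OF this]
  have "(\<integral>\<omega>. h (U \<omega>, V \<omega>) \<partial>M) = (\<integral>u. (\<integral>z. h (u, z) \<partial>distr M D V) \<partial>distr M N U)"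
    by (simp add: joint integral_distr)
  also have "\<dots> = (\<integral>\<omega>. (\<integral>z. h (U \<omega>, z) \<partial>distr M D V) \<partial>M)"
    by (rule integral_distr) measurable
  finally show ?thesis .
qed

text \<open>Tonelli instead of Fubini: with no integrability required in advance, it can be used to
  prove that squared gradients are integrable.\<close>

lemma (in prob_space) nn_integral_indep_pair:
  assumes [measurable]: "U \<in> measurable M N" "V \<in> measurable M D"
    and joint: "distr M N U \<Otimes>\<^sub>M distr M D V = distr M (N \<Otimes>\<^sub>M D) (\<lambda>\<omega>. (U \<omega>, V \<omega>))"
    and h[measurable]: "h \<in> borel_measurable (N \<Otimes>\<^sub>M D)"
  shows "(\<integral>\<^sup>+\<omega>. h (U \<omega>, V \<omega>) \<partial>M) = (\<integral>\<^sup>+\<omega>. (\<integral>\<^sup>+z. h (U \<omega>, z) \<partial>distr M D V) \<partial>M)"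
proof -
  interpret V: prob_space "distr M D V" by (rule prob_space_distr) simp
  have "(\<integral>\<^sup>+\<omega>. h (U \<omega>, V \<omega>) \<partial>M) = (\<integral>\<^sup>+p. h p \<partial>(distr M N U \<Otimes>\<^sub>M distr M D V))"
    unfolding joint by (rule nn_integral_distr[symmetric]) measurable
  also have "\<dots> = (\<integral>\<^sup>+u. (\<integral>\<^sup>+z. h (u, z) \<partial>distr M D V) \<partial>distr M N U)"
    by (rule V.nn_integral_fst[symmetric]) measurable
  also have "\<dots> = (\<integral>\<^sup>+\<omega>. (\<integral>\<^sup>+z. h (U \<omega>, z) \<partial>distr M D V) \<partial>M)"
    by (rule nn_integral_distr) measurable
  finally show ?thesis .
qed

text \<open>Bias-variance decomposition. It converts the variance hypothesis, which concerns the
  centered oracle, into a bound on the full second moment.\<close>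

lemma (in prob_space) integral_norm_square_centered:
  fixes X :: "'a \<Rightarrow> 'b::euclidean_space"
  assumes X: "integrable M X" and var: "integrable M (\<lambda>\<omega>. (norm (X \<omega> - expectation X))\<^sup>2)"
  shows "integrable M (\<lambda>\<omega>. (norm (X \<omega>))\<^sup>2)"
    and "expectation (\<lambda>\<omega>. (norm (X \<omega>))\<^sup>2)
      = expectation (\<lambda>\<omega>. (norm (X \<omega> - expectation X))\<^sup>2) + (norm (expectation X))\<^sup>2"
proof -
  let ?m = "expectation X"
  have eq: "(\<lambda>\<omega>. (norm (X \<omega>))\<^sup>2)
      = (\<lambda>\<omega>. (norm (X \<omega> - ?m))\<^sup>2 + (2 * (X \<omega> \<bullet> ?m) - (norm ?m)\<^sup>2))"
    by (rule ext) (simp add: power2_norm_eq_inner inner_simps inner_commute)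
  have i: "integrable M (\<lambda>\<omega>. 2 * (X \<omega> \<bullet> ?m) - (norm ?m)\<^sup>2)"
    using X by simp
  show "integrable M (\<lambda>\<omega>. (norm (X \<omega>))\<^sup>2)"
    unfolding eq using var i by (rule Bochner_Integration.integrable_add)
  show "expectation (\<lambda>\<omega>. (norm (X \<omega>))\<^sup>2)
      = expectation (\<lambda>\<omega>. (norm (X \<omega> - ?m))\<^sup>2) + (norm ?m)\<^sup>2"
    unfolding eq Bochner_Integration.integral_add[OF var i]
    using X by (simp add: prob_space power2_norm_eq_inner)
qed

subsection \<open>The SUM iteration\<close>

text \<open>The state after \<open>k\<close> steps is the pair \<open>(x\<^sub>k, y\<^sup>s\<^sub>k)\<close>.\<close>

primrec sum_state ::
    "real \<Rightarrow> real \<Rightarrow> real \<Rightarrow> ('a::euclidean_space \<Rightarrow> 'z \<Rightarrow> 'a) \<Rightarrow> 'a \<Rightarrow> nat \<Rightarrow> (nat \<Rightarrow> 'z) \<Rightarrow> 'a \<times> 'a"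
where
  "sum_state \<alpha> \<beta> s \<G> x0 0 z = (x0, x0)"
| "sum_state \<alpha> \<beta> s \<G> x0 (Suc k) z =
    (let (x, y) = sum_state \<alpha> \<beta> s \<G> x0 k z; g = \<G> x (z k); y' = x - (s * \<alpha>) *\<^sub>R g
     in (x - \<alpha> *\<^sub>R g + \<beta> *\<^sub>R (y' - y), y'))"

text \<open>Causality: sample \<open>k\<close> first enters at step \<open>Suc k\<close>.
  Restricting the samples to \<open>{..<k}\<close> therefore leaves the state unchanged, which is
  what gives independence from sample \<open>k\<close>.\<close>

lemma sum_state_cong:
  "(\<And>i. i < k \<Longrightarrow> z i = z' i) \<Longrightarrow> sum_state \<alpha> \<beta> s \<G> x0 k z = sum_state \<alpha> \<beta> s \<G> x0 k z'"
  by (induction k) simp_all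

lemma SUM_method_eq_sum_state:
  assumes "SUM_method \<alpha> \<beta> s \<G> z x0 x"
  shows "x k = fst (sum_state \<alpha> \<beta> s \<G> x0 k z)"
proof -
  obtain y ys where "x 0 = x0" "ys 0 = x0"
    "\<And>k. y (Suc k) = x k - \<alpha> *\<^sub>R \<G> (x k) (z k)"
    "\<And>k. ys (Suc k) = x k - (s * \<alpha>) *\<^sub>R \<G> (x k) (z k)"
    "\<And>k. x (Suc k) = y (Suc k) + \<beta> *\<^sub>R (ys (Suc k) - ys k)"
    using assms unfolding SUM_method_def by blast
  \<comment> \<open>The induction must carry the pair, since the next iterate also depends on
    \<open>ys k\<close>.\<close>
  then have "(x k, ys k) = sum_state \<alpha> \<beta> s \<G> x0 k z"
    by (induction k) (simp_all add: Let_def split_beta flip: prod.collapse, metis fst_conv snd_conv)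
  then show ?thesis
    by (metis fst_conv)
qed

text \<open>The index set \<open>J\<close> stays fixed while \<open>k\<close> grows; with
  \<open>{..<k}\<close> itself, the induction hypothesis would live on a different product
  space.\<close>

lemma measurable_sum_state:
  fixes \<G> :: "'a::euclidean_space \<Rightarrow> 'z \<Rightarrow> 'a"
  assumes G[measurable]: "(\<lambda>(x, z). \<G> x z) \<in> borel_measurable (borel \<Otimes>\<^sub>M D)"
    and "{..<k} \<subseteq> J"
  shows "sum_state \<alpha> \<beta> s \<G> x0 k \<in> measurable (PiM J (\<lambda>_. D)) (borel \<Otimes>\<^sub>M borel)"
  using assms(2)
proof (induction k)
  case 0
  show ?case by simp
next
  case (Suc k)
  have [measurable]: "sum_state \<alpha> \<beta> s \<G> x0 k \<in> measurable (PiM J (\<lambda>_. D)) (borel \<Otimes>\<^sub>M borel)"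
    using Suc by (intro Suc.IH) auto
  have [measurable]: "(\<lambda>z. z k) \<in> measurable (PiM J (\<lambda>_. D)) D"
    using Suc.prems by (intro measurable_component_singleton) auto
  show ?case
    by (simp add: Let_def split_beta)
qed

section \<open>The random process and its shifted iterate\<close>

locale sum_process = M: prob_space M + D: prob_space D
  for M :: "'w measure" and D :: "'z measure" +
  fixes f :: "'a::euclidean_space \<Rightarrow> real"
    and \<G> :: "'a \<Rightarrow> 'z \<Rightarrow> 'a"
    and \<xi> :: "nat \<Rightarrow> 'w \<Rightarrow> 'z"
    and x0 x_star :: 'a
    and \<alpha> \<beta> s \<delta> G :: real
  assumes indep: "M.indep_vars (\<lambda>_. D) \<xi> UNIV"
    and ident: "\<And>k. distr M D (\<xi> k) = D"
    and convex: "convex_on UNIV f"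
    and subgrad: "stochastic_subgradient f D \<G>"
    and variance: "\<And>u. integrable D (\<lambda>z. (norm (\<G> u z - (\<integral>z'. \<G> u z' \<partial>D)))\<^sup>2) \<and>
      (\<integral>z. (norm (\<G> u z - (\<integral>z'. \<G> u z' \<partial>D)))\<^sup>2 \<partial>D) \<le> \<delta>\<^sup>2"
    and bounded: "\<And>u g. g \<in> subdifferential f u \<Longrightarrow> norm g \<le> G"
    and minimizer: "\<And>u. f x_star \<le> f u"
    and \<beta>: "0 \<le> \<beta>" "\<beta> < 1" and s: "0 \<le> s" and \<alpha>: "0 < \<alpha>"
begin

definition mean_grad :: "'a \<Rightarrow> 'a"
  where "mean_grad u = (\<integral>z. \<G> u z \<partial>D)"

definition X :: "nat \<Rightarrow> 'w \<Rightarrow> 'a"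
  where "X k \<omega> = fst (sum_state \<alpha> \<beta> s \<G> x0 k (\<lambda>i. \<xi> i \<omega>))"

definition Y :: "nat \<Rightarrow> 'w \<Rightarrow> 'a"
  where "Y k \<omega> = snd (sum_state \<alpha> \<beta> s \<G> x0 k (\<lambda>i. \<xi> i \<omega>))"

definition grad :: "nat \<Rightarrow> 'w \<Rightarrow> 'a"
  where "grad k \<omega> = \<G> (X k \<omega>) (\<xi> k \<omega>)"

text \<open>The shifted iterate is taken relative to \<open>x_star\<close>, so that its squared norm
  is the distance followed by the recursion.\<close>

definition P :: "nat \<Rightarrow> 'w \<Rightarrow> 'a"
  where "P k \<omega> = X k \<omega> + (\<beta> / (1 - \<beta>)) *\<^sub>R (X k \<omega> - Y k \<omega>) - x_star"

lemma X_0: "X 0 \<omega> = x0" and Y_0: "Y 0 \<omega> = x0"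
  by (simp_all add: X_def Y_def)

lemma Y_Suc: "Y (Suc k) \<omega> = X k \<omega> - (s * \<alpha>) *\<^sub>R grad k \<omega>"
  by (simp add: X_def Y_def grad_def Let_def split_beta)

lemma X_Suc: "X (Suc k) \<omega> = X k \<omega> - \<alpha> *\<^sub>R grad k \<omega> + \<beta> *\<^sub>R (Y (Suc k) \<omega> - Y k \<omega>)"
  by (simp add: X_def Y_def grad_def Let_def split_beta)

lemma P_0: "P 0 \<omega> = x0 - x_star"
  by (simp add: P_def X_0 Y_0)

lemma P_Suc: "P (Suc k) \<omega> = P k \<omega> - (\<alpha> / (1 - \<beta>)) *\<^sub>R grad k \<omega>"
proof -
  define c where "c = \<beta> / (1 - \<beta>)"
  \<comment> \<open>The weight \<open>c\<close> is the solution of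
    \<open>\<beta> + c * \<beta> = c\<close>. This cancels the momentum \<open>?x - ?y\<close> and,
    with it, every term containing \<open>s\<close>; what is left is the gradient with coefficient
    \<open>\<alpha> + c * \<alpha>\<close>.\<close>
  have b: "\<beta> + c * \<beta> = c" and a: "\<alpha> / (1 - \<beta>) = \<alpha> + c * \<alpha>"
    using \<beta> by (simp_all add: c_def field_simps)
  let ?x = "X k \<omega>" and ?y = "Y k \<omega>" and ?g = "grad k \<omega>"
  have "P (Suc k) \<omega> - P k \<omega> + (\<alpha> / (1 - \<beta>)) *\<^sub>R ?g
     = (\<beta> + c * \<beta> - c) *\<^sub>R (?x - ?y) + (c * s * \<alpha> - (\<beta> + c * \<beta>) * s * \<alpha>) *\<^sub>R ?g"
    unfolding P_def X_Suc Y_Suc c_def[symmetric] a by (simp add: algebra_simps)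
  also have "\<dots> = 0"
    by (simp only: b) simp
  finally show ?thesis
    by (simp add: algebra_simps)
qed

lemma measurable_oracle[measurable]: "(\<lambda>(x, z). \<G> x z) \<in> borel_measurable (borel \<Otimes>\<^sub>M D)"
  and integrable_oracle: "integrable D (\<G> u)"
  and mean_grad_subdifferential: "mean_grad u \<in> subdifferential f u"
  using subgrad by (auto simp: stochastic_subgradient_def mean_grad_def)

lemma measurable_mean_grad[measurable]: "mean_grad \<in> borel_measurable borel"
  unfolding mean_grad_def[abs_def] by measurable

lemma measurable_f[measurable]: "f \<in> borel_measurable borel"
  using convex_on_continuous[OF open_UNIV convex] by (rule borel_measurable_continuous_onI)

lemma measurable_sample[measurable]: "\<xi> k \<in> measurable M D"
  using indep by (auto simp: M.indep_vars_def)

lemma norm_mean_grad_le: "norm (mean_grad u) \<le> G"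
  by (rule bounded[OF mean_grad_subdifferential])

lemma mean_grad_ineq: "f u - f v \<le> mean_grad u \<bullet> (u - v)"
proof -
  have "f v \<ge> f u + mean_grad u \<bullet> (v - u)"
    using mean_grad_subdifferential[of u] by (simp add: subdifferential_def)
  then show ?thesis
    by (simp add: inner_simps)
qed

section \<open>Measurability of the iterates and independence of the next sample\<close>

lemma measurable_state[measurable]:
  "sum_state \<alpha> \<beta> s \<G> x0 k \<in> measurable (PiM {..<k} (\<lambda>_. D)) (borel \<Otimes>\<^sub>M borel)"
  by (rule measurable_sum_state) auto

lemma measurable_X[measurable]: "X k \<in> borel_measurable M"
  and measurable_Y[measurable]: "Y k \<in> borel_measurable M"
proof -
  have "(\<lambda>\<omega>. sum_state \<alpha> \<beta> s \<G> x0 k (restrict (\<lambda>i. \<xi> i \<omega>) {..<k}))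
      \<in> measurable M (borel \<Otimes>\<^sub>M borel)"
    by measurable
  also have "(\<lambda>\<omega>. sum_state \<alpha> \<beta> s \<G> x0 k (restrict (\<lambda>i. \<xi> i \<omega>) {..<k}))
      = (\<lambda>\<omega>. (X k \<omega>, Y k \<omega>))"
    by (auto simp: fun_eq_iff X_def Y_def intro!: sum_state_cong)
  finally have "(\<lambda>\<omega>. (X k \<omega>, Y k \<omega>)) \<in> measurable M (borel \<Otimes>\<^sub>M borel)" .
  from measurable_compose[OF this measurable_fst] measurable_compose[OF this measurable_snd]
  show "X k \<in> borel_measurable M" "Y k \<in> borel_measurable M"
    by simp_all
qed

text \<open>The state is a function of the samples before \<open>k\<close>, a block of indices
  disjoint from \<open>{k}\<close>.\<close>

lemma state_sample_law:
  "distr M (borel \<Otimes>\<^sub>M borel) (\<lambda>\<omega>. (X k \<omega>, Y k \<omega>)) \<Otimes>\<^sub>M distr M D (\<xi> k)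
    = distr M ((borel \<Otimes>\<^sub>M borel) \<Otimes>\<^sub>M D) (\<lambda>\<omega>. ((X k \<omega>, Y k \<omega>), \<xi> k \<omega>))"
proof -
  \<comment> \<open>Sample \<open>k\<close> is treated as a family over \<open>{k}\<close>, so both
    blocks have the same function type; the projection at \<open>k\<close> extracts it
    afterwards.\<close>
  have ind: "M.indep_var (PiM {..<k} (\<lambda>_. D)) (\<lambda>\<omega>. restrict (\<lambda>i. \<xi> i \<omega>) {..<k})
      (PiM {k} (\<lambda>_. D)) (\<lambda>\<omega>. restrict (\<lambda>i. \<xi> i \<omega>) {k})"
    by (rule M.indep_var_restrict[OF indep]) auto
  have "sum_state \<alpha> \<beta> s \<G> x0 k (restrict (\<lambda>i. \<xi> i \<omega>) {..<k}) = (X k \<omega>, Y k \<omega>)" for \<omega>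
    by (auto simp: X_def Y_def intro!: sum_state_cong)
  with M.joint_law_compose[OF ind measurable_state
      measurable_component_singleton[of k]]
  show ?thesis
    by simp
qed

lemma measurable_grad[measurable]: "grad k \<in> borel_measurable M"
  unfolding grad_def[abs_def] by measurable

section \<open>Second moments and integrability\<close>

text \<open>The variance contributes \<open>\<delta>\<^sup>2\<close> and the squared mean, a
  subgradient, contributes \<open>G\<^sup>2\<close>. The bound is uniform in \<open>u\<close>, so it
  survives substituting the random iterate.\<close>

lemma nn_integral_oracle_square: "(\<integral>\<^sup>+z. (norm (\<G> u z))\<^sup>2 \<partial>D) \<le> ennreal (G\<^sup>2 + \<delta>\<^sup>2)"
proof -
  have "(norm (mean_grad u))\<^sup>2 \<le> G\<^sup>2"
    by (intro power_mono norm_mean_grad_le) simp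
  then have "(\<integral>z. (norm (\<G> u z))\<^sup>2 \<partial>D) \<le> G\<^sup>2 + \<delta>\<^sup>2"
    using D.integral_norm_square_centered(2)[OF integrable_oracle[of u]] variance[of u]
    by (simp add: mean_grad_def)
  then show ?thesis
    using D.integral_norm_square_centered(1)[OF integrable_oracle[of u]] variance[of u]
    by (simp add: nn_integral_eq_integral ennreal_leI del: ennreal_plus)
qed

text \<open>Freezing the state in the nonnegative integral reduces to the uniform oracle bound.
  Integrability follows from finiteness, so no moment of \<open>X k\<close> has to be known
  beforehand.\<close>

lemma square_integrable_grad: "square_integrable M (grad k)"
  and expectation_grad_square: "(\<integral>\<omega>. (norm (grad k \<omega>))\<^sup>2 \<partial>M) \<le> G\<^sup>2 + \<delta>\<^sup>2"
proof -
  have "(\<integral>\<^sup>+\<omega>. (norm (grad k \<omega>))\<^sup>2 \<partial>M) = (\<integral>\<^sup>+\<omega>. (\<integral>\<^sup>+z. (norm (\<G> (X k \<omega>) z))\<^sup>2 \<partial>D) \<partial>M)"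
    using M.nn_integral_indep_pair[OF _ _ state_sample_law[of k],
        of "\<lambda>(p, z). ennreal ((norm (\<G> (fst p) z))\<^sup>2)"]
    by (simp add: ident grad_def)
  also have "\<dots> \<le> (\<integral>\<^sup>+\<omega>. ennreal (G\<^sup>2 + \<delta>\<^sup>2) \<partial>M)"
    by (intro nn_integral_mono nn_integral_oracle_square)
  finally have le: "(\<integral>\<^sup>+\<omega>. (norm (grad k \<omega>))\<^sup>2 \<partial>M) \<le> ennreal (G\<^sup>2 + \<delta>\<^sup>2)"
    by (simp add: M.emeasure_space_1)
  then have int: "integrable M (\<lambda>\<omega>. (norm (grad k \<omega>))\<^sup>2)"
    by (intro integrableI_bounded) (auto intro: le_less_trans)
  then show "square_integrable M (grad k)"
    by (simp add: square_integrable_def)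
  show "(\<integral>\<omega>. (norm (grad k \<omega>))\<^sup>2 \<partial>M) \<le> G\<^sup>2 + \<delta>\<^sup>2"
    using le int by (simp add: nn_integral_eq_integral del: ennreal_plus)
qed

lemma square_integrable_state: "square_integrable M (X k) \<and> square_integrable M (Y k)"
proof (induction k)
  case 0
  have "X 0 = (\<lambda>_. x0)" "Y 0 = (\<lambda>_. x0)"
    by (auto simp: X_0 Y_0)
  then show ?case
    by (simp add: M.square_integrable_const)
next
  case (Suc k)
  have Y: "square_integrable M (Y (Suc k))"
    unfolding Y_Suc[abs_def] using Suc
    by (intro square_integrable_intros square_integrable_grad) auto
  moreover have "square_integrable M (X (Suc k))"
    unfolding X_Suc[abs_def] using Suc Y
    by (intro square_integrable_intros square_integrable_grad) auto
  ultimately show ?case by simp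
qed

lemmas square_integrable_X = square_integrable_state[THEN conjunct1]
  and square_integrable_Y = square_integrable_state[THEN conjunct2]

lemma square_integrable_P: "square_integrable M (P k)"
  unfolding P_def[abs_def]
  by (intro square_integrable_intros square_integrable_X square_integrable_Y
      M.square_integrable_const)

lemma square_integrable_mean_grad: "square_integrable M (\<lambda>\<omega>. mean_grad (X k \<omega>))"
  unfolding square_integrable_def
proof
  show "integrable M (\<lambda>\<omega>. (norm (mean_grad (X k \<omega>)))\<^sup>2)"
    by (rule M.integrable_const_bound[where B = "G\<^sup>2"])
      (auto intro!: power_mono norm_mean_grad_le)
qed measurable

text \<open>Without a growth condition on \<open>f\<close>, the gap is squeezed between 0, by
  minimality, and an integrable inner product, by the subgradient inequality.\<close>

lemma integrable_gap: "integrable M (\<lambda>\<omega>. f (X k \<omega>) - f x_star)"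
proof (rule Bochner_Integration.integrable_bound)
  show "integrable M (\<lambda>\<omega>. mean_grad (X k \<omega>) \<bullet> (X k \<omega> - x_star))"
    by (intro integrable_inner_square_integrable square_integrable_intros
        square_integrable_mean_grad square_integrable_X M.square_integrable_const)
  show "AE \<omega> in M. norm (f (X k \<omega>) - f x_star)
      \<le> norm (mean_grad (X k \<omega>) \<bullet> (X k \<omega> - x_star))"
  proof (rule AE_I2)
    fix \<omega>
    show "norm (f (X k \<omega>) - f x_star) \<le> norm (mean_grad (X k \<omega>) \<bullet> (X k \<omega> - x_star))"
      using minimizer[of "X k \<omega>"] mean_grad_ineq[of "X k \<omega>" x_star] by simp
  qed
qed measurable

section \<open>The expected gap and the one-step recursion\<close>

definition gap :: "nat \<Rightarrow> real"
  where "gap k = (\<integral>\<omega>. f (X k \<omega>) - f x_star \<partial>M)"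

lemma gap_nonneg: "0 \<le> gap k"
  unfolding gap_def using minimizer by (intro Bochner_Integration.integral_nonneg) simp

lemma gap_0: "gap 0 = f x0 - f x_star"
  by (simp add: gap_def X_0 M.prob_space)

text \<open>\<open>P k\<close> depends only on the state, so with the state frozen the inner product
  is linear in the oracle and its mean over the sample involves only
  \<open>mean_grad\<close>.\<close>

lemma expectation_grad_inner_P:
  "(\<integral>\<omega>. grad k \<omega> \<bullet> P k \<omega> \<partial>M) = (\<integral>\<omega>. mean_grad (X k \<omega>) \<bullet> P k \<omega> \<partial>M)"
proof -
  let ?h = "\<lambda>(p, z). \<G> (fst p) z \<bullet> (fst p + (\<beta> / (1 - \<beta>)) *\<^sub>R (fst p - snd p) - x_star)"
  have "integrable M (\<lambda>\<omega>. grad k \<omega> \<bullet> P k \<omega>)"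
    by (intro integrable_inner_square_integrable square_integrable_grad square_integrable_P)
  then show ?thesis
    using M.integral_indep_pair[OF _ _ state_sample_law[of k], of ?h]
    by (simp add: ident grad_def P_def integrable_oracle mean_grad_def)
qed

text \<open>
  Truncated subtraction makes the bound valid at \<open>k = 0\<close>, where \<open>x\<^sub>0 = y\<^sup>s\<^sub>0\<close>.
\<close>

lemma mean_grad_inner_momentum:
  "f (X k \<omega>) - f (X (k - 1) \<omega>) - s * \<alpha> / 2 * (G\<^sup>2 + (norm (grad (k - 1) \<omega>))\<^sup>2)
    \<le> mean_grad (X k \<omega>) \<bullet> (X k \<omega> - Y k \<omega>)"
proof (cases k)
  case 0
  then show ?thesis
    using s \<alpha> by (simp add: X_0 Y_0)
next
  case (Suc j)
  let ?m = "mean_grad (X k \<omega>)" and ?g = "grad j \<omega>"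
  have "(norm ?m)\<^sup>2 \<le> G\<^sup>2"
    by (intro power_mono norm_mean_grad_le) simp
  \<comment> \<open>Young's inequality is used rather than Cauchy-Schwarz alone because it leaves a
    squared gradient norm, whose expectation is already bounded.\<close>
  with abs_le_D2[OF abs_inner_le_half_squares[of ?m ?g]]
  have "- (?m \<bullet> ?g) \<le> (G\<^sup>2 + (norm ?g)\<^sup>2) / 2"
    by (simp add: field_simps)
  then have "(s * \<alpha>) * (- (?m \<bullet> ?g)) \<le> (s * \<alpha>) * ((G\<^sup>2 + (norm ?g)\<^sup>2) / 2)"
    using s \<alpha> by (intro mult_left_mono) auto
  moreover have "?m \<bullet> (X k \<omega> - Y k \<omega>) = ?m \<bullet> (X k \<omega> - X j \<omega>) + (s * \<alpha>) * (?m \<bullet> ?g)"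
    unfolding Suc Y_Suc by (simp add: inner_simps)
  ultimately show ?thesis
    using mean_grad_ineq[of "X k \<omega>" "X j \<omega>"] by (simp add: Suc algebra_simps)
qed

text \<open>\<open>P k\<close> splits into \<open>X k - x_star\<close>, which yields the gap, and a
  multiple of the momentum, which yields the gap difference minus an error.\<close>

lemma expectation_mean_grad_inner_P:
  "gap k + \<beta> / (1 - \<beta>) * (gap k - gap (k - 1) - s * \<alpha> * (G\<^sup>2 + \<delta>\<^sup>2))
    \<le> (\<integral>\<omega>. mean_grad (X k \<omega>) \<bullet> P k \<omega> \<partial>M)"
proof -
  define c where "c = \<beta> / (1 - \<beta>)"
  have c: "0 \<le> c"
    using \<beta> by (simp add: c_def)
  define d where "d j \<omega> = f (X j \<omega>) - f x_star" for j \<omega>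
  have d: "integrable M (d j)" "gap j = integral\<^sup>L M (d j)" for j
    using integrable_gap[of j] by (simp_all add: d_def[abs_def] gap_def)
  let ?q = "\<lambda>\<omega>. (norm (grad (k - 1) \<omega>))\<^sup>2"
  let ?L = "\<lambda>\<omega>. d k \<omega> + c * (d k \<omega> - d (k - 1) \<omega> - s * \<alpha> / 2 * (G\<^sup>2 + ?q \<omega>))"
  have q: "integrable M ?q"
    using square_integrable_grad by (simp add: square_integrable_def)
  have L: "integrable M ?L"
    by (intro Bochner_Integration.integrable_add Bochner_Integration.integrable_diff
        Bochner_Integration.integrable_mult_right d q M.integrable_const)
  have "c * (gap k - gap (k - 1) - s * \<alpha> / 2 * (G\<^sup>2 + (G\<^sup>2 + \<delta>\<^sup>2)))
      \<le> c * (gap k - gap (k - 1) - s * \<alpha> / 2 * (G\<^sup>2 + integral\<^sup>L M ?q))"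
    using c s \<alpha> expectation_grad_square[of "k - 1"]
    by (intro mult_left_mono diff_left_mono add_left_mono) auto
  \<comment> \<open>Half of \<open>2 * G\<^sup>2 + \<delta>\<^sup>2\<close> is enlarged to
    \<open>G\<^sup>2 + \<delta>\<^sup>2\<close>, so that both error terms of the recursion share one
    factor.\<close>
  moreover have "c * (gap k - gap (k - 1) - s * \<alpha> * (G\<^sup>2 + \<delta>\<^sup>2))
      \<le> c * (gap k - gap (k - 1) - s * \<alpha> / 2 * (G\<^sup>2 + (G\<^sup>2 + \<delta>\<^sup>2)))"
    using c s \<alpha> by (intro mult_left_mono diff_left_mono) (auto simp: field_simps)
  moreover have "integral\<^sup>L M ?L
      = gap k + c * (gap k - gap (k - 1) - s * \<alpha> / 2 * (G\<^sup>2 + integral\<^sup>L M ?q))"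
    using d(1) q by (simp add: d(2) M.prob_space)
  moreover have "integral\<^sup>L M ?L \<le> (\<integral>\<omega>. mean_grad (X k \<omega>) \<bullet> P k \<omega> \<partial>M)"
  proof (rule integral_mono[OF L])
    show "integrable M (\<lambda>\<omega>. mean_grad (X k \<omega>) \<bullet> P k \<omega>)"
      by (intro integrable_inner_square_integrable square_integrable_mean_grad square_integrable_P)
    fix \<omega>
    have "mean_grad (X k \<omega>) \<bullet> P k \<omega> = mean_grad (X k \<omega>) \<bullet> (X k \<omega> - x_star)
        + c * (mean_grad (X k \<omega>) \<bullet> (X k \<omega> - Y k \<omega>))"
      by (simp add: P_def c_def inner_simps algebra_simps)
    moreover have "c * (d k \<omega> - d (k - 1) \<omega> - s * \<alpha> / 2 * (G\<^sup>2 + ?q \<omega>))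
        \<le> c * (mean_grad (X k \<omega>) \<bullet> (X k \<omega> - Y k \<omega>))"
      using mean_grad_inner_momentum[of k \<omega>] c by (intro mult_left_mono) (simp_all add: d_def)
    ultimately show "?L \<omega> \<le> mean_grad (X k \<omega>) \<bullet> P k \<omega>"
      using mean_grad_ineq[of "X k \<omega>" x_star] by (simp add: d_def)
  qed
  ultimately show ?thesis
    unfolding c_def by linarith
qed

text \<open>Expanding the square of a plain gradient step leaves a cross term, bounded through the
  mean subgradient, and a second-moment term.\<close>

lemma expectation_P_square_step:
  "(\<integral>\<omega>. (norm (P (Suc k) \<omega>))\<^sup>2 \<partial>M) \<le> (\<integral>\<omega>. (norm (P k \<omega>))\<^sup>2 \<partial>M)
    - 2 * (\<alpha> / (1 - \<beta>)) *
      (gap k + \<beta> / (1 - \<beta>) * (gap k - gap (k - 1) - s * \<alpha> * (G\<^sup>2 + \<delta>\<^sup>2)))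
    + (\<alpha> / (1 - \<beta>))\<^sup>2 * (G\<^sup>2 + \<delta>\<^sup>2)"
proof -
  define a where "a = \<alpha> / (1 - \<beta>)"
  have a: "0 < a"
    using \<alpha> \<beta> by (simp add: a_def)
  have P: "integrable M (\<lambda>\<omega>. (norm (P k \<omega>))\<^sup>2)" and g: "integrable M (\<lambda>\<omega>. (norm (grad k \<omega>))\<^sup>2)"
    using square_integrable_P square_integrable_grad by (auto simp: square_integrable_def)
  have gP: "integrable M (\<lambda>\<omega>. grad k \<omega> \<bullet> P k \<omega>)"
    by (intro integrable_inner_square_integrable square_integrable_grad square_integrable_P)
  have "(norm (P (Suc k) \<omega>))\<^sup>2
      = (norm (P k \<omega>))\<^sup>2 - 2 * a * (grad k \<omega> \<bullet> P k \<omega>) + a\<^sup>2 * (norm (grad k \<omega>))\<^sup>2" for \<omega>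
    unfolding P_Suc a_def[symmetric]
    by (simp add: power2_norm_eq_inner inner_simps inner_commute)
      (simp add: power2_eq_square algebra_simps)
  then have "(\<integral>\<omega>. (norm (P (Suc k) \<omega>))\<^sup>2 \<partial>M) = (\<integral>\<omega>. (norm (P k \<omega>))\<^sup>2 \<partial>M)
      - 2 * a * (\<integral>\<omega>. grad k \<omega> \<bullet> P k \<omega> \<partial>M) + a\<^sup>2 * (\<integral>\<omega>. (norm (grad k \<omega>))\<^sup>2 \<partial>M)"
    using P g gP by simp
  moreover have "a\<^sup>2 * (\<integral>\<omega>. (norm (grad k \<omega>))\<^sup>2 \<partial>M) \<le> a\<^sup>2 * (G\<^sup>2 + \<delta>\<^sup>2)"
    by (intro mult_left_mono expectation_grad_square) simp
  moreover have "2 * a * (gap k + \<beta> / (1 - \<beta>) * (gap k - gap (k - 1) - s * \<alpha> * (G\<^sup>2 + \<delta>\<^sup>2)))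
      \<le> 2 * a * (\<integral>\<omega>. grad k \<omega> \<bullet> P k \<omega> \<partial>M)"
    unfolding expectation_grad_inner_P
    using a by (intro mult_left_mono expectation_mean_grad_inner_P) simp
  ultimately show ?thesis
    unfolding a_def by linarith
qed

section \<open>Summation over the steps\<close>

text \<open>The gap differences telescope; the one at step 0 vanishes because
  \<open>0 - 1 = 0\<close>. The momentum error is still charged there, hence the factor
  \<open>real n + 1\<close>.\<close>

lemma sum_gap_telescoped:
  "(\<integral>\<omega>. (norm (P (Suc n) \<omega>))\<^sup>2 \<partial>M)
    + 2 * (\<alpha> / (1 - \<beta>)) * ((\<Sum>k=0..n. gap k) + \<beta> / (1 - \<beta>) * (gap n - gap 0))
    \<le> (norm (x0 - x_star))\<^sup>2 + (real n + 1) *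
      (2 * (\<alpha> / (1 - \<beta>)) * (\<beta> / (1 - \<beta>)) * s * \<alpha> + (\<alpha> / (1 - \<beta>))\<^sup>2) * (G\<^sup>2 + \<delta>\<^sup>2)"
proof -
  define a c where "a = \<alpha> / (1 - \<beta>)" and "c = \<beta> / (1 - \<beta>)"
  note step = expectation_P_square_step[folded a_def c_def]
  show ?thesis
    unfolding a_def[symmetric] c_def[symmetric]
  proof (induction n)
    case 0
    show ?case
      using step[of 0] by (simp add: P_0 M.prob_space algebra_simps)
  next
    case (Suc n)
    then show ?case
      using step[of "Suc n"] by (simp add: algebra_simps)
  qed
qed

lemma mean_gap_le:
  "(\<Sum>k=0..n. gap k) / (real n + 1) \<le> \<beta> * (f x0 - f x_star) / ((1 - \<beta>) * (real n + 1))
    + (1 - \<beta>) * (norm (x0 - x_star))\<^sup>2 / (2 * \<alpha> * (real n + 1))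
    + \<alpha> * (1 + 2 * s * \<beta>) * (G\<^sup>2 + \<delta>\<^sup>2) / (2 * (1 - \<beta>))"
proof -
  define r N B S where "r = 1 - \<beta>" and "N = real n + 1" and "B = G\<^sup>2 + \<delta>\<^sup>2"
    and "S = (\<Sum>k=0..n. gap k)"
  have pos: "0 < r" "0 < N"
    using \<beta> by (simp_all add: r_def N_def)
  have "0 \<le> (\<integral>\<omega>. (norm (P (Suc n) \<omega>))\<^sup>2 \<partial>M)"
    by (intro Bochner_Integration.integral_nonneg) simp
  moreover define a c where "a = \<alpha> / r" and "c = \<beta> / r"
  \<comment> \<open>The final gap and the final squared distance are both nonnegative and are
    dropped; of the telescoped sum only \<open>gap 0\<close> remains.\<close>
  have "0 \<le> 2 * a * (c * gap n)"
    using gap_nonneg[of n] \<alpha> \<beta> pos by (simp add: a_def c_def)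
  ultimately have "2 * a * (S - c * gap 0)
      \<le> (norm (x0 - x_star))\<^sup>2 + N * (2 * a * c * s * \<alpha> + a\<^sup>2) * B"
    using sum_gap_telescoped[of n]
    unfolding r_def[symmetric] a_def[symmetric] c_def[symmetric] N_def[symmetric]
      B_def[symmetric] S_def[symmetric] right_diff_distrib distrib_left
    by linarith
  then have "2 * (\<alpha> / r) * (S - \<beta> / r * gap 0)
      \<le> (norm (x0 - x_star))\<^sup>2 + N * (2 * (\<alpha> / r) * (\<beta> / r) * s * \<alpha> + (\<alpha> / r)\<^sup>2) * B"
    unfolding a_def c_def .
  \<comment> \<open>The multiplier is \<open>1 / (2 * a * N)\<close>, which turns the left side into
    the mean gap minus the initial-gap term.\<close>
  then have "(2 * (\<alpha> / r) * (S - \<beta> / r * gap 0)) * (r / (2 * \<alpha> * N))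
      \<le> ((norm (x0 - x_star))\<^sup>2 + N * (2 * (\<alpha> / r) * (\<beta> / r) * s * \<alpha> + (\<alpha> / r)\<^sup>2) * B)
        * (r / (2 * \<alpha> * N))"
    using pos \<alpha> by (intro mult_right_mono) auto
  also have "(2 * (\<alpha> / r) * (S - \<beta> / r * gap 0)) * (r / (2 * \<alpha> * N))
      = S / N - \<beta> * gap 0 / (r * N)"
    using pos \<alpha> by (simp add: field_simps)
  \<comment> \<open>The plain step error becomes \<open>\<alpha> * B / (2 * r)\<close> and the
    momentum error is \<open>2 * s * \<beta>\<close> times as large, giving the factor
    \<open>1 + 2 * s * \<beta>\<close>.\<close>
  also have "((norm (x0 - x_star))\<^sup>2 + N * (2 * (\<alpha> / r) * (\<beta> / r) * s * \<alpha> + (\<alpha> / r)\<^sup>2) * B)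
        * (r / (2 * \<alpha> * N))
      = r * (norm (x0 - x_star))\<^sup>2 / (2 * \<alpha> * N) + \<alpha> * (1 + 2 * s * \<beta>) * B / (2 * r)"
    using pos \<alpha> by (simp add: field_simps power2_eq_square)
  finally show ?thesis
    unfolding gap_0 r_def N_def B_def S_def by simp
qed

section \<open>Averaging the iterates\<close>

text \<open>Jensen's inequality with equal weights. It also bounds the nonnegative gap of the
  average by an integrable function.\<close>

lemma
  fixes n :: nat
  defines "avg \<equiv> \<lambda>\<omega>. (1 / (real n + 1)) *\<^sub>R (\<Sum>k=0..n. X k \<omega>)"
  shows integrable_gap_average: "integrable M (\<lambda>\<omega>. f (avg \<omega>) - f x_star)"
    and expectation_gap_average:
      "(\<integral>\<omega>. f (avg \<omega>) - f x_star \<partial>M) \<le> (\<Sum>k=0..n. gap k) / (real n + 1)"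
proof -
  let ?u = "\<lambda>\<omega>. \<Sum>k=0..n. (1 / (real n + 1)) * (f (X k \<omega>) - f x_star)"
  have jensen: "f (avg \<omega>) - f x_star \<le> ?u \<omega>" for \<omega>
  proof -
    have "f (\<Sum>k=0..n. (1 / (real n + 1)) *\<^sub>R X k \<omega>) \<le> (\<Sum>k=0..n. (1 / (real n + 1)) * f (X k \<omega>))"
      by (intro convex_on_sum[OF _ _ convex]) (auto simp: field_simps)
    moreover have "(\<Sum>k=0..n. (1 / (real n + 1)) * f x_star) = f x_star"
      by (simp add: field_simps)
    ultimately show ?thesis
      unfolding avg_def scaleR_sum_right right_diff_distrib sum_subtractf by linarith
  qed
  have [measurable]: "avg \<in> borel_measurable M"
    unfolding avg_def by measurable
  have u: "integrable M ?u"
    by (intro Bochner_Integration.integrable_sum Bochner_Integration.integrable_mult_right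
        integrable_gap)
  show int: "integrable M (\<lambda>\<omega>. f (avg \<omega>) - f x_star)"
  proof (rule Bochner_Integration.integrable_bound[OF u])
    show "AE \<omega> in M. norm (f (avg \<omega>) - f x_star) \<le> norm (?u \<omega>)"
    proof (rule AE_I2)
      fix \<omega>
      show "norm (f (avg \<omega>) - f x_star) \<le> norm (?u \<omega>)"
        using jensen[of \<omega>] minimizer[of "avg \<omega>"] by (simp only: real_norm_def)
    qed
  qed measurable
  have "(\<integral>\<omega>. f (avg \<omega>) - f x_star \<partial>M) \<le> integral\<^sup>L M ?u"
    by (intro integral_mono int u jensen)
  also have "integral\<^sup>L M ?u = (\<Sum>k=0..n. (1 / (real n + 1)) * gap k)"
    unfolding gap_def
    using integrable_gap by simp
  finally show "(\<integral>\<omega>. f (avg \<omega>) - f x_star \<partial>M) \<le> (\<Sum>k=0..n. gap k) / (real n + 1)"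
    by (simp add: sum_divide_distrib)
qed

end

section \<open>Specialization to the prescribed step size\<close>

theorem theorem1:
  fixes f :: "real ^ 'd \<Rightarrow> real"
    and \<G> :: "real ^ 'd \<Rightarrow> 'z \<Rightarrow> real ^ 'd"
    and D :: "'z measure"
    and M :: "'w measure"
    and \<xi> :: "nat \<Rightarrow> 'w \<Rightarrow> 'z"
    and x :: "nat \<Rightarrow> 'w \<Rightarrow> real ^ 'd"
    and x0 x_star :: "real ^ 'd"
    and \<beta> s C \<delta> G :: real
    and t :: nat
  assumes "prob_space M"
    and "prob_space D"
    and indep: "prob_space.indep_vars M (\<lambda>_. D) \<xi> UNIV"
    and ident: "\<And>k. distr M D (\<xi> k) = D"
    and convex: "convex_on UNIV f"
    and subgrad: "stochastic_subgradient f D \<G>"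
    and variance: "\<And>u. integrable D (\<lambda>z. (norm (\<G> u z - (\<integral>z'. \<G> u z' \<partial>D)))\<^sup>2) \<and>
      (\<integral>z. (norm (\<G> u z - (\<integral>z'. \<G> u z' \<partial>D)))\<^sup>2 \<partial>D) \<le> \<delta>\<^sup>2"
    and bounded: "\<And>u g. g \<in> subdifferential f u \<Longrightarrow> norm g \<le> G"
    and minimizer: "\<And>u. f x_star \<le> f u"
    and "0 \<le> \<beta>" and "\<beta> < 1" and "0 \<le> s" and "0 < C"
    and SUM: "\<And>\<omega>. \<omega> \<in> space M \<Longrightarrow>
      SUM_method (C / sqrt (real t + 1)) \<beta> s \<G> (\<lambda>k. \<xi> k \<omega>) x0 (\<lambda>k. x k \<omega>)"
  shows "integrable M (\<lambda>\<omega>. f ((1 / (real t + 1)) *\<^sub>R (\<Sum>k=0..t. x k \<omega>)) - f x_star) \<and>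
    (\<integral>\<omega>. f ((1 / (real t + 1)) *\<^sub>R (\<Sum>k=0..t. x k \<omega>)) - f x_star \<partial>M) \<le>
      \<beta> * (f x0 - f x_star) / ((1 - \<beta>) * (real t + 1)) +
      (1 - \<beta>) * (norm (x0 - x_star))\<^sup>2 / (2 * C * sqrt (real t + 1)) +
      C * (1 + 2 * s * \<beta>) * (G\<^sup>2 + \<delta>\<^sup>2) / (2 * (1 - \<beta>) * sqrt (real t + 1))"
proof -
  define N where "N = real t + 1"
  define \<alpha> where "\<alpha> = C / sqrt N"
  have N: "0 < N"
    by (simp add: N_def)
  interpret M: prob_space M by fact
  interpret D: prob_space D by fact
  interpret sum_process M D f \<G> \<xi> x0 x_star \<alpha> \<beta> s \<delta> G
  proof
    show "0 < \<alpha>"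
      using \<open>0 < C\<close> N by (simp add: \<alpha>_def)
  qed (use assms in auto)
  \<comment> \<open>The given iterates are constrained only on \<open>space M\<close>, which is
    enough for integrability and integrals to agree.\<close>
  have x_eq: "x k \<omega> = X k \<omega>" if "\<omega> \<in> space M" for k \<omega>
    unfolding X_def using SUM[OF that]
    by (intro SUM_method_eq_sum_state) (simp add: \<alpha>_def N_def)
  let ?h = "\<lambda>x \<omega>. f ((1 / (real t + 1)) *\<^sub>R (\<Sum>k=0..t. x k \<omega>)) - f x_star"
  have h: "?h x \<omega> = ?h X \<omega>" if "\<omega> \<in> space M" for \<omega>
    using x_eq[OF that] by simp
  have int: "integrable M (?h x)"
    using integrable_gap_average[of t]
    by (subst Bochner_Integration.integrable_cong[OF refl h])
  have "integral\<^sup>L M (?h x) = integral\<^sup>L M (?h X)"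
    by (rule Bochner_Integration.integral_cong[OF refl h])
  \<comment> \<open>This is where the step size balances the bound: the distance term has
    \<open>\<alpha> * N\<close> in its denominator and the noise term is proportional to
    \<open>\<alpha>\<close>, so both decay like \<open>1 / sqrt N\<close>.\<close>
  moreover have "\<alpha> * N = C * sqrt N"
    using N real_div_sqrt[of N] by (simp add: \<alpha>_def flip: times_divide_eq_right)
  then have "(1 - \<beta>) * (norm (x0 - x_star))\<^sup>2 / (2 * \<alpha> * N)
      = (1 - \<beta>) * (norm (x0 - x_star))\<^sup>2 / (2 * C * sqrt N)"
    by (simp add: mult.assoc)
  moreover have "\<alpha> * (1 + 2 * s * \<beta>) * (G\<^sup>2 + \<delta>\<^sup>2) / (2 * (1 - \<beta>))
      = C * (1 + 2 * s * \<beta>) * (G\<^sup>2 + \<delta>\<^sup>2) / (2 * (1 - \<beta>) * sqrt N)"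
    by (simp add: \<alpha>_def)
  ultimately show ?thesis
    using expectation_gap_average[of t] mean_gap_le[of t]
    by (intro conjI int) (simp only: N_def)
qed

end
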